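(* Let $\mathcal{X}$ be a non-empty finite set. For each integer $n\geq1$ let $\mathcal{R}^n\subseteq\mathcal{G}(\mathcal{X}^n)$ be a set of gambles on $\mathcal{X}^n$, and put $\mathcal{S}^n:=\mathrm{Hy}^n(\mathcal{R}^n)$ and $\mathcal{H}^n:=\mathrm{Mn}^n(\mathcal{R}^n)=\mathrm{CoMn}^n(\mathcal{S}^n)$. Then the family $(\mathcal{R}^n)_{n\geq1}$ is time-consistent, coherent and exchangeable if and only if there is some Bernstein coherent set $\mathcal{H}\subseteq\mathcal{V}(\Sigma_{\mathcal{X}})$ of polynomials such that, for all $n\geq1$, $$\mathcal{S}^n=(\mathrm{CoMn}^n)^{-1}(\mathcal{H})\quad\text{and}\quad\mathcal{R}^n=(\mathrm{Mn}^n)^{-1}(\mathcal{H}),$$ and in that case this $\mathcal{H}$ is uniquely given by $\mathcal{H}=\bigcup_{n\geq1}\mathcal{H}^n$.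
   Context: A gamble on a non-empty set $\Omega$ is a bounded function $\Omega\to\mathbb{R}$; $\mathcal{G}(\Omega)$ is the linear space of all gambles on $\Omega$. Write $f\geq g$ for the pointwise ordering, and $f>g$ iff $f\geq g$ and $f\neq g$. A set $\mathcal{R}\subseteq\mathcal{G}(\Omega)$ is coherent if: $0\notin\mathcal{R}$; $f>0$ implies $f\in\mathcal{R}$; $f\in\mathcal{R}$ and $\lambda>0$ imply $\lambda f\in\mathcal{R}$; $f_1,f_2\in\mathcal{R}$ implies $f_1+f_2\in\mathcal{R}$. For a permutation $\pi$ of $\{1,\dots,n\}$ put $\pi(x_1,\dots,x_n)=(x_{\pi(1)},\dots,x_{\pi(n)})$ and $\pi^tf=f\circ\pi$. A coherent set $\mathcal{R}\subseteq\mathcal{G}(\mathcal{X}^n)$ is exchangeable if $h+(f-\pi^tf)\in\mathcal{R}$ for all $h\in\mathcal{R}$, $f\in\mathcal{G}(\mathcal{X}^n)$ and all permutations $\pi$. For $1\leq n_1\leq n_2$ and $f\in\mathcal{G}(\mathcal{X}^{n_1})$, the cylindrical extension $\mathrm{ext}_{n_1}^{n_2}(f)\in\mathcal{G}(\mathcal{X}^{n_2})$ is $\mathrm{ext}_{n_1}^{n_2}(f)(x_1,\dots,x_{n_2})=f(x_1,\dots,x_{n_1})$. The family $(\mathcal{R}^n)_{n\geq1}$ is time-consistent, coherent and exchangeable if each $\mathcal{R}^n$ is coherent and exchangeable and $\mathrm{ext}_{n_1}^{n_2}(\mathcal{R}^{n_1})=\mathcal{R}^{n_2}\cap\mathrm{ext}_{n_1}^{n_2}(\mathcal{G}(\mathcal{X}^{n_1}))$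 for all $1\leq n_1\leq n_2$. For $n\geq0$, $\mathcal{N}^n=\{m\in\mathbb{Z}_{\geq0}^{\mathcal{X}}:\sum_zm_z=n\}$. For $m\in\mathcal{N}^n$, $[m]$ is the set of $x\in\mathcal{X}^n$ in which each $z\in\mathcal{X}$ occurs exactly $m_z$ times; $|[m]|=n!/\prod_zm_z!$. $\mathrm{Hy}^n:\mathcal{G}(\mathcal{X}^n)\to\mathcal{G}(\mathcal{N}^n)$, $\mathrm{Hy}^n(f)(m)=\frac{1}{|[m]|}\sum_{y\in[m]}f(y)$. $\Sigma_{\mathcal{X}}=\{\theta\in\mathbb{R}^{\mathcal{X}}:\theta\geq0,\sum_x\theta_x=1\}$; $B_m(\theta)=|[m]|\prod_z\theta_z^{m_z}$ for $m\in\mathcal{N}^n$ ($0^0=1$). $\mathcal{V}(\Sigma_{\mathcal{X}})$ is the linear space of polynomial functions on $\Sigma_{\mathcal{X}}$, $\mathcal{V}^n(\Sigma_{\mathcal{X}})$ the subspace of those of degree at most $n$, and $\deg(p)$ is the smallest $n\ge 0$ with $p\in\mathcal{V}^n(\Sigma_{\mathcal{X}})$. For $n\geq\deg(p)$ there is a unique $b_p^n\in\mathcal{G}(\mathcal{N}^n)$ (the Bernstein expansion of $p$ of degree $n$) with $p=\sum_{m\in\mathcal{N}^n}b_p^n(m)B_m$. Define $\mathrm{CoMn}^n:\mathcal{G}(\mathcal{N}^n)\to\mathcal{V}(\Sigma_{\mathcal{X}})$, $\mathrm{CoMn}^n(g)=\sum_{m\in\mathcal{N}^n}g(m)B_m$,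 and $\mathrm{Mn}^n=\mathrm{CoMn}^n\circ\mathrm{Hy}^n$. A set $\mathcal{H}\subseteq\mathcal{V}(\Sigma_{\mathcal{X}})$ is Bernstein coherent if for all $p,p_1,p_2\in\mathcal{V}(\Sigma_{\mathcal{X}})$ and real $\lambda>0$: $0\notin\mathcal{H}$; if $b_p^n>0$ for some $n\geq\deg(p)$ then $p\in\mathcal{H}$; $p\in\mathcal{H}$ implies $\lambda p\in\mathcal{H}$; $p_1,p_2\in\mathcal{H}$ implies $p_1+p_2\in\mathcal{H}$. *)

theory Defs
  imports "HOL-Analysis.Analysis" "HOL-Combinatorics.Permutations"
begin

text \<open>
  The finite non-empty set of outcomes is the type \<open>'x::finite\<close>. A function on a set \<open>\<Omega>\<close> is
  represented by the total function that agrees with it on \<open>\<Omega>\<close> and is \<open>0\<close> off \<open>\<Omega>\<close>, so that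
  equality, the pointwise order and the library's \<open><\<close> on functions have their usual meaning
  on \<open>\<Omega>\<close>.
\<close>

definition zero_ext :: "'a set \<Rightarrow> ('a \<Rightarrow> real) \<Rightarrow> 'a \<Rightarrow> real" where
  "zero_ext \<Omega> f = (\<lambda>x. if x \<in> \<Omega> then f x else 0)"

definition gambles :: "'a set \<Rightarrow> ('a \<Rightarrow> real) set" where
  "gambles \<Omega> = {f. bounded (f ` \<Omega>) \<and> (\<forall>x. x \<notin> \<Omega> \<longrightarrow> f x = 0)}"

definition coherent :: "'a set \<Rightarrow> ('a \<Rightarrow> real) set \<Rightarrow> bool" where
  "coherent \<Omega> R \<longleftrightarrow>
     R \<subseteq> gambles \<Omega> \<and>
     (\<lambda>x. 0) \<notin> R \<and>
     (\<forall>f\<in>gambles \<Omega>. (\<lambda>x. 0) < f \<longrightarrow> f \<in> R) \<and>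
     (\<forall>f\<in>R. \<forall>c::real. c > 0 \<longrightarrow> (\<lambda>x. c * f x) \<in> R) \<and>
     (\<forall>f1\<in>R. \<forall>f2\<in>R. (\<lambda>x. f1 x + f2 x) \<in> R)"

definition seqs :: "nat \<Rightarrow> 'x list set" where
  "seqs n = {x. length x = n}"

text \<open>
  Positions in a sequence are numbered from \<open>0\<close>; for \<open>\<pi> permutes {..<n}\<close>, the term
  \<open>permute_list \<pi> x\<close> is the sequence whose \<open>i\<close>-th entry is \<open>x ! \<pi> i\<close>.
\<close>

definition exchangeable :: "nat \<Rightarrow> ('x list \<Rightarrow> real) set \<Rightarrow> bool" where
  "exchangeable n R \<longleftrightarrow>
     (\<forall>h\<in>R. \<forall>f\<in>gambles (seqs n). \<forall>\<pi>. \<pi> permutes {..<n} \<longrightarrow>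
        (\<lambda>x. h x + (f x - (f \<circ> permute_list \<pi>) x)) \<in> R)"

definition cyl_ext :: "nat \<Rightarrow> nat \<Rightarrow> ('x list \<Rightarrow> real) \<Rightarrow> 'x list \<Rightarrow> real" where
  "cyl_ext n1 n2 f = zero_ext (seqs n2) (\<lambda>x. f (take n1 x))"

definition time_consistent :: "(nat \<Rightarrow> ('x list \<Rightarrow> real) set) \<Rightarrow> bool" where
  "time_consistent R \<longleftrightarrow>
     (\<forall>n1 n2. 1 \<le> n1 \<and> n1 \<le> n2 \<longrightarrow>
        cyl_ext n1 n2 ` R n1 = R n2 \<inter> cyl_ext n1 n2 ` gambles (seqs n1))"

definition tc_coherent_exchangeable :: "(nat \<Rightarrow> ('x list \<Rightarrow> real) set) \<Rightarrow> bool" where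
  "tc_coherent_exchangeable R \<longleftrightarrow>
     (\<forall>n\<ge>1. coherent (seqs n) (R n) \<and> exchangeable n (R n)) \<and> time_consistent R"

definition count_vecs :: "nat \<Rightarrow> ('x::finite \<Rightarrow> nat) set" where
  "count_vecs n = {m. (\<Sum>z\<in>UNIV. m z) = n}"

definition perm_class :: "('x::finite \<Rightarrow> nat) \<Rightarrow> 'x list set" where
  "perm_class m = {x \<in> seqs (\<Sum>z\<in>UNIV. m z). \<forall>z. count_list x z = m z}"

definition Hy :: "nat \<Rightarrow> ('x::finite list \<Rightarrow> real) \<Rightarrow> ('x \<Rightarrow> nat) \<Rightarrow> real" where
  "Hy n f = zero_ext (count_vecs n)
     (\<lambda>m. 1 / real (card (perm_class m)) * (\<Sum>y\<in>perm_class m. f y))"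

definition prob_simplex :: "(real ^ 'x::finite) set" where
  "prob_simplex = {\<theta>. (\<forall>z. 0 \<le> \<theta> $ z) \<and> (\<Sum>z\<in>UNIV. \<theta> $ z) = 1}"

definition bernstein :: "('x::finite \<Rightarrow> nat) \<Rightarrow> real ^ 'x \<Rightarrow> real" where
  "bernstein m = zero_ext prob_simplex
     (\<lambda>\<theta>. real (card (perm_class m)) * (\<Prod>z\<in>UNIV. (\<theta> $ z) ^ m z))"

text \<open>
  Restrictions to the simplex of multivariate polynomials of total degree at most \<open>n\<close>, with
  \<open>c \<alpha>\<close> the coefficient of the monomial with exponent vector \<open>\<alpha>\<close>.
\<close>

definition polys_upto :: "nat \<Rightarrow> (real ^ 'x::finite \<Rightarrow> real) set" where
  "polys_upto n = {zero_ext prob_simplex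
       (\<lambda>\<theta>. \<Sum>\<alpha> | (\<Sum>z\<in>UNIV. \<alpha> z) \<le> n. c \<alpha> * (\<Prod>z\<in>UNIV. (\<theta> $ z) ^ \<alpha> z))
     | c :: ('x \<Rightarrow> nat) \<Rightarrow> real. True}"

definition polys :: "(real ^ 'x::finite \<Rightarrow> real) set" where
  "polys = (\<Union>n. polys_upto n)"

definition poly_deg :: "(real ^ 'x::finite \<Rightarrow> real) \<Rightarrow> nat" where
  "poly_deg p = (LEAST n. p \<in> polys_upto n)"

definition CoMn :: "nat \<Rightarrow> (('x::finite \<Rightarrow> nat) \<Rightarrow> real) \<Rightarrow> real ^ 'x \<Rightarrow> real" where
  "CoMn n g = (\<lambda>\<theta>. \<Sum>m\<in>count_vecs n. g m * bernstein m \<theta>)"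

definition Mn :: "nat \<Rightarrow> ('x::finite list \<Rightarrow> real) \<Rightarrow> real ^ 'x \<Rightarrow> real" where
  "Mn n = CoMn n \<circ> Hy n"

text \<open>Only meaningful for \<open>p \<in> polys\<close> and \<open>poly_deg p \<le> n\<close>.\<close>

definition bernstein_expansion ::
    "nat \<Rightarrow> (real ^ 'x::finite \<Rightarrow> real) \<Rightarrow> ('x \<Rightarrow> nat) \<Rightarrow> real" where
  "bernstein_expansion n p =
     (THE b. b \<in> gambles (count_vecs n) \<and>
             p = (\<lambda>\<theta>. \<Sum>m\<in>count_vecs n. b m * bernstein m \<theta>))"

definition bernstein_coherent :: "(real ^ 'x::finite \<Rightarrow> real) set \<Rightarrow> bool" where
  "bernstein_coherent H \<longleftrightarrow>
     H \<subseteq> polys \<and>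
     (\<lambda>\<theta>. 0) \<notin> H \<and>
     (\<forall>p\<in>polys. (\<exists>n\<ge>poly_deg p. (\<lambda>m. 0) < bernstein_expansion n p) \<longrightarrow> p \<in> H) \<and>
     (\<forall>p\<in>H. \<forall>c::real. c > 0 \<longrightarrow> (\<lambda>\<theta>. c * p \<theta>) \<in> H) \<and>
     (\<forall>p1\<in>H. \<forall>p2\<in>H. (\<lambda>\<theta>. p1 \<theta> + p2 \<theta>) \<in> H)"

definition represents ::
    "(real ^ 'x::finite \<Rightarrow> real) set \<Rightarrow> (nat \<Rightarrow> ('x list \<Rightarrow> real) set) \<Rightarrow> bool" where
  "represents H R \<longleftrightarrow>
     (\<forall>n\<ge>1. Hy n ` R n = {g \<in> gambles (count_vecs n). CoMn n g \<in> H} \<and>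
             R n = {f \<in> gambles (seqs n). Mn n f \<in> H})"

end

theory Submission
  imports Defs "HOL-Computational_Algebra.Polynomial"
begin

text \<open>
  For \<open>\<theta>\<close> in the simplex, \<open>Mn n f \<theta>\<close> is the expectation of \<open>f\<close> under \<open>n\<close> independent draws from \<open>\<theta>\<close>.
  Hence \<open>Mn\<close> is unchanged by cylindrical extension. It is also unchanged by permuting arguments, and
  up to such permutations it loses nothing: the Bernstein polynomials of degree \<open>n\<close> are linearly
  independent, so \<open>Mn n f\<close> determines \<open>Hy n f\<close>, and the kernel of \<open>Hy n\<close> is spanned by the gambles
  \<open>f - f \<circ> permute_list \<pi>\<close>. Exchangeability and time consistency therefore say exactly that membership
  of \<open>f\<close> in \<open>R n\<close> depends only on the polynomial \<open>Mn n f\<close>, and since every polynomial on the simplex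
  is of this form, \<open>H\<close> and \<open>R\<close> determine each other.
\<close>

section \<open>Gambles on finite sets\<close>

lemma finite_seqs [simp]: "finite (seqs n :: 'x::finite list set)"
  using finite_lists_length_eq[of "UNIV :: 'x set" n] by (simp add: seqs_def)

lemma finite_count_vecs_le: "finite {m :: 'x::finite \<Rightarrow> nat. (\<Sum>z\<in>UNIV. m z) \<le> n}"
proof (rule finite_subset)
  show "{m :: 'x \<Rightarrow> nat. (\<Sum>z\<in>UNIV. m z) \<le> n} \<subseteq> PiE UNIV (\<lambda>_. {..n})"
    by (auto simp: PiE_def) (meson finite member_le_sum order_trans UNIV_I zero_le)
qed (auto intro: finite_PiE)

lemma finite_count_vecs [simp]: "finite (count_vecs n :: ('x::finite \<Rightarrow> nat) set)"
  by (rule finite_subset[OF _ finite_count_vecs_le[of n]]) (auto simp: count_vecs_def)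

text \<open>Every function on a finite set is bounded, so only the normalisation to zero off
  \<open>\<Omega>\<close> remains to be checked.\<close>

lemma mem_gambles_iff: "finite \<Omega> \<Longrightarrow> f \<in> gambles \<Omega> \<longleftrightarrow> (\<forall>x. x \<notin> \<Omega> \<longrightarrow> f x = 0)"
  by (simp add: gambles_def finite_imp_bounded)

lemma zero_ext_in_gambles: "finite \<Omega> \<Longrightarrow> zero_ext \<Omega> f \<in> gambles \<Omega>"
  by (simp add: mem_gambles_iff zero_ext_def)

lemma gambles_cmult: "f \<in> gambles \<Omega> \<Longrightarrow> (\<lambda>x. c * f x) \<in> gambles \<Omega>"
  unfolding gambles_def using bounded_scaleR_comp[of f \<Omega> c] by auto

lemma gambles_add: "f \<in> gambles \<Omega> \<Longrightarrow> g \<in> gambles \<Omega> \<Longrightarrow> (\<lambda>x. f x + g x) \<in> gambles \<Omega>"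
  unfolding gambles_def using bounded_plus_comp[of f \<Omega> g] by auto

lemma gambles_diff: "f \<in> gambles \<Omega> \<Longrightarrow> g \<in> gambles \<Omega> \<Longrightarrow> (\<lambda>x. f x - g x) \<in> gambles \<Omega>"
  unfolding gambles_def using bounded_minus_comp[of f \<Omega> g] by auto

lemma zero_in_gambles [simp]: "(\<lambda>x. 0) \<in> gambles \<Omega>"
  by (auto simp: gambles_def intro: bounded_subset[of "{0}"])

lemma zero_less_fun_iff: "(\<lambda>x. 0) < f \<longleftrightarrow> (\<forall>x. 0 \<le> f x) \<and> (\<exists>x. 0 < (f x :: real))"
  by (auto simp: less_fun_def le_fun_def not_le)

section \<open>Count vectors and permutation classes\<close>

lemma sum_count_list: "(\<Sum>z\<in>UNIV. count_list x z) = length (x :: 'x::finite list)"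
  by (simp add: sum_count_set)

lemma count_list_in_count_vecs [simp]: "x \<in> seqs n \<Longrightarrow> count_list x \<in> count_vecs n"
  by (simp add: seqs_def count_vecs_def sum_count_list)

lemma perm_class_eq: "m \<in> count_vecs n \<Longrightarrow> perm_class m = {x \<in> seqs n. count_list x = m}"
  by (auto simp: perm_class_def count_vecs_def fun_eq_iff)

lemma finite_perm_class [simp]: "finite (perm_class m)"
  by (simp add: perm_class_def)

text \<open>List \<open>m z\<close> copies of each \<open>z\<close> in any order. This keeps the
  divisor in \<open>Hy\<close> and the leading factor in \<open>bernstein\<close> nonzero.\<close>

lemma perm_class_nonempty [simp]: "perm_class m \<noteq> {}"
proof -
  define M where "M = (\<Sum>z\<in>UNIV. replicate_mset (m z) z)"
  obtain x where x: "mset x = M"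
    using ex_mset by blast
  have "count_list x z = m z" for z
    by (simp add: count_mset[symmetric] x M_def count_sum)
  then have "x \<in> perm_class m"
    by (simp add: perm_class_def seqs_def sum_count_list[symmetric])
  then show ?thesis
    by blast
qed

lemma card_perm_class_pos [simp]: "0 < card (perm_class m)"
  by (simp add: card_gt_0_iff)

text \<open>Equal counts mean equal multisets, and two lists with the same multiset differ by a
  permutation of positions.\<close>

lemma perm_class_permute:
  assumes "x \<in> seqs n" "y \<in> perm_class (count_list x)"
  obtains \<sigma> where "\<sigma> permutes {..<n}" "y = permute_list \<sigma> x"
proof -
  have "count_list y = count_list x"
    using assms by (simp add: perm_class_eq[of _ n])
  then have "mset y = mset x"
    by (simp add: multiset_eq_iff count_mset)
  then show ?thesis
    using mset_eq_permutation[of y x] assms(1) that by (auto simp: seqs_def)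
qed

lemma permute_list_in_perm_class:
  assumes "m \<in> count_vecs n" "\<pi> permutes {..<n}" "y \<in> perm_class m"
  shows "permute_list \<pi> y \<in> perm_class m"
proof -
  have "length y = n" "count_list y = m"
    using assms(1,3) by (auto simp: perm_class_eq seqs_def)
  moreover have "count_list (permute_list \<pi> y) z = count_list y z" for z
    using assms(2) \<open>length y = n\<close> by (simp add: count_mset[symmetric])
  ultimately show ?thesis
    using assms(1) by (auto simp: perm_class_eq seqs_def)
qed

text \<open>Permuting positions is a bijection of the class onto itself, with the inverse
  permutation as its inverse.\<close>

lemma sum_perm_class_permute:
  assumes m: "m \<in> count_vecs n" and p: "\<pi> permutes {..<n}"
  shows "(\<Sum>y\<in>perm_class m. f (permute_list \<pi> y)) = (\<Sum>y\<in>perm_class m. f y)"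
proof (rule sum.reindex_bij_witness[where i = "permute_list (inv \<pi>)" and j = "permute_list \<pi>"])
  fix y assume y: "y \<in> perm_class m"
  have len: "length y = n"
    using m y by (simp add: perm_class_eq seqs_def)
  have q: "inv \<pi> permutes {..<n}"
    using p by (rule permutes_inv)
  show "permute_list (inv \<pi>) (permute_list \<pi> y) = y"
    using permute_list_compose[of "inv \<pi>" y \<pi>] q len permutes_inv_o[OF p] by simp
  show "permute_list \<pi> (permute_list (inv \<pi>) y) = y"
    using permute_list_compose[of \<pi> y "inv \<pi>"] p len permutes_inv_o[OF p] by simp
  show "permute_list \<pi> y \<in> perm_class m" "permute_list (inv \<pi>) y \<in> perm_class m"
    using permute_list_in_perm_class[OF m] p q y by blast+
qed simp

section \<open>The map \<open>Hy\<close>\<close>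

lemma Hy_in_gambles [simp]: "Hy n f \<in> gambles (count_vecs n)"
  by (simp add: Hy_def zero_ext_in_gambles)

lemma Hy_cmult: "Hy n (\<lambda>x. c * f x) = (\<lambda>m. c * Hy n f m)"
  by (auto simp: Hy_def zero_ext_def sum_distrib_left[symmetric])

lemma Hy_add: "Hy n (\<lambda>x. f x + g x) = (\<lambda>m. Hy n f m + Hy n g m)"
  by (auto simp: Hy_def zero_ext_def sum.distrib add_divide_distrib)

lemma Hy_diff: "Hy n (\<lambda>x. f x - g x) = (\<lambda>m. Hy n f m - Hy n g m)"
  by (auto simp: Hy_def zero_ext_def sum_subtractf diff_divide_distrib)

lemma Hy_permute: "\<pi> permutes {..<n} \<Longrightarrow> Hy n (f \<circ> permute_list \<pi>) = Hy n f"
  by (auto simp: Hy_def zero_ext_def fun_eq_iff sum_perm_class_permute)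

text \<open>All class averages are nonnegative, and the one over the class of a point where
  \<open>f\<close> is positive is strictly positive.\<close>

lemma Hy_pos:
  assumes "f \<in> gambles (seqs n)" "(\<lambda>x. 0) < f"
  shows "(\<lambda>m. 0) < Hy n f"
proof -
  have nonneg: "0 \<le> f x" for x
    using assms(2) by (simp add: zero_less_fun_iff)
  obtain x where x: "0 < f x"
    using assms(2) by (auto simp: zero_less_fun_iff)
  then have xs: "x \<in> seqs n"
    using assms(1) by (auto simp: mem_gambles_iff)
  have "0 < (\<Sum>y\<in>perm_class (count_list x). f y)"
    using x xs nonneg by (intro sum_pos2[of _ x]) (auto simp: perm_class_eq[of _ n])
  then have "0 < Hy n f (count_list x)"
    using xs by (simp add: Hy_def zero_ext_def)
  moreover have "0 \<le> Hy n f m" for m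
    using nonneg by (simp add: Hy_def zero_ext_def sum_nonneg)
  ultimately show ?thesis
    unfolding zero_less_fun_iff by blast
qed

text \<open>A right inverse of \<open>Hy n\<close> on gambles: the lifted gamble is constant on each
  permutation class, so averaging returns the value.\<close>

definition count_gamble :: "nat \<Rightarrow> (('x::finite \<Rightarrow> nat) \<Rightarrow> real) \<Rightarrow> 'x list \<Rightarrow> real" where
  "count_gamble n g = zero_ext (seqs n) (\<lambda>x. g (count_list x))"

lemma count_gamble_in_gambles [simp]: "count_gamble n g \<in> gambles (seqs n)"
  by (simp add: count_gamble_def zero_ext_in_gambles)

lemma Hy_count_gamble:
  assumes "g \<in> gambles (count_vecs n)"
  shows "Hy n (count_gamble n g) = g"
proof
  fix m
  have "m \<in> count_vecs n \<Longrightarrow> (\<Sum>y\<in>perm_class m. count_gamble n g y) = (\<Sum>y\<in>perm_class m. g m)"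
    by (rule sum.cong) (auto simp: count_gamble_def zero_ext_def perm_class_eq)
  then show "Hy n (count_gamble n g) m = g m"
    using assms by (auto simp: Hy_def zero_ext_def mem_gambles_iff)
qed

lemma count_gamble_pos:
  assumes "g \<in> gambles (count_vecs n)" "(\<lambda>m. 0) < g"
  shows "(\<lambda>x. 0) < count_gamble n g"
proof -
  obtain m where m: "0 < g m"
    using assms(2) by (auto simp: zero_less_fun_iff)
  then have mc: "m \<in> count_vecs n"
    using assms(1) by (auto simp: mem_gambles_iff)
  then obtain x where "x \<in> seqs n" "count_list x = m"
    using perm_class_nonempty[of m] by (auto simp: perm_class_eq)
  then have "0 < count_gamble n g x"
    using m by (simp add: count_gamble_def zero_ext_def)
  moreover have "0 \<le> count_gamble n g x" for x
    using assms(2) by (simp add: zero_less_fun_iff count_gamble_def zero_ext_def)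
  ultimately show ?thesis
    unfolding zero_less_fun_iff by blast
qed

text \<open>The sum \<open>F\<close> is constant on the class of \<open>x\<close>. Its total over
  the class is therefore a positive multiple of \<open>F x\<close>, but it is also
  \<open>fact n\<close> times the class sum of \<open>f\<close>, which is zero.\<close>

lemma sum_permutations_eq_0:
  assumes Hy0: "Hy n f = (\<lambda>m. 0)" and x: "x \<in> seqs n"
  shows "(\<Sum>\<pi> | \<pi> permutes {..<n}. f (permute_list \<pi> x)) = 0"
proof -
  let ?P = "{\<pi>. \<pi> permutes {..<n}}" and ?C = "perm_class (count_list x)"
  define F where "F y = (\<Sum>\<pi>\<in>?P. f (permute_list \<pi> y))" for y
  have F_invariant: "F y = F x" if "y \<in> ?C" for y
  proof -
    obtain \<sigma> where \<sigma>: "\<sigma> permutes {..<n}" "y = permute_list \<sigma> x"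
      using perm_class_permute x \<open>y \<in> ?C\<close> by metis
    \<comment> \<open>\<open>permute_list\<close> reverses composition: permuting by
      \<open>\<sigma>\<close> and then by \<open>\<pi>\<close> is permuting by
      \<open>\<sigma> \<circ> \<pi>\<close>. Left composition with \<open>\<sigma>\<close> merely
      reorders the sum over all permutations.\<close>
    have "F y = (\<Sum>\<pi>\<in>?P. f (permute_list (\<sigma> \<circ> \<pi>) x))"
      unfolding F_def \<sigma> using x by (intro sum.cong) (auto simp: permute_list_compose seqs_def)
    also have "\<dots> = F x"
      unfolding F_def by (rule setum_permutations_compose_left[OF \<sigma>(1), symmetric])
    finally show ?thesis .
  qed
  have "(\<Sum>y\<in>?C. f y) = 0"
    using fun_cong[OF Hy0, of "count_list x"] x
    by (simp add: Hy_def zero_ext_def)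
  moreover have "(\<Sum>y\<in>?C. F y) = (\<Sum>\<pi>\<in>?P. \<Sum>y\<in>?C. f (permute_list \<pi> y))"
    unfolding F_def by (rule sum.swap)
  moreover have "\<dots> = (\<Sum>\<pi>\<in>?P. \<Sum>y\<in>?C. f y)"
    by (rule sum.cong) (use x in \<open>auto intro: sum_perm_class_permute[of _ n]\<close>)
  moreover have "(\<Sum>y\<in>?C. F y) = real (card ?C) * F x"
    by (simp add: F_invariant)
  ultimately have "real (card ?C) * F x = 0"
    by simp
  then show ?thesis
    using card_perm_class_pos[of "count_list x"] by (simp add: F_def)
qed

text \<open>
  A gamble \<open>f\<close> in the kernel of \<open>Hy n\<close> is the average of \<open>f - f \<circ> permute_list \<pi>\<close> over all \<open>\<pi>\<close>,
  so an exchangeable set can absorb it one permutation at a time.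
\<close>

lemma exchangeable_Hy_cong:
  fixes R :: "('x::finite list \<Rightarrow> real) set"
  assumes exch: "exchangeable n R" and h: "h \<in> R" "h \<in> gambles (seqs n)"
    and h': "h' \<in> gambles (seqs n)" and Hy_eq: "Hy n h = Hy n h'"
  shows "h' \<in> R"
proof -
  let ?P = "{\<pi>. \<pi> permutes {..<n}}"
  define f where "f x = h' x - h x" for x
  \<comment> \<open>With this factor, the sum over all \<open>fact n\<close> permutations adds up to
    \<open>f\<close> once the permuted terms have cancelled, and adding \<open>f\<close> carries
    \<open>h\<close> to \<open>h'\<close>.\<close>
  define g where "g x = 1 / fact n * f x" for x
  have f: "f \<in> gambles (seqs n)"
    unfolding f_def using h' h(2) by (rule gambles_diff)
  then have g: "g \<in> gambles (seqs n)"
    unfolding g_def by (rule gambles_cmult)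
  have step: "(\<lambda>x. h x + (\<Sum>\<pi>\<in>P. g x - g (permute_list \<pi> x))) \<in> R" if "finite P" "P \<subseteq> ?P" for P
    using that
  proof (induction P rule: finite_induct)
    case (insert \<pi> P)
    have "(\<lambda>x. h x + (\<Sum>\<pi>\<in>P. g x - g (permute_list \<pi> x))) \<in> R" "\<pi> permutes {..<n}"
      using insert by auto
    then have "(\<lambda>x. (h x + (\<Sum>\<pi>\<in>P. g x - g (permute_list \<pi> x))) + (g x - (g \<circ> permute_list \<pi>) x)) \<in> R"
      using exch[unfolded exchangeable_def, rule_format] g by fastforce
    moreover have "h x + (\<Sum>\<pi>\<in>P. g x - g (permute_list \<pi> x)) + (g x - (g \<circ> permute_list \<pi>) x)
        = h x + (\<Sum>\<pi>\<in>insert \<pi> P. g x - g (permute_list \<pi> x))" for x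
      using insert.hyps by (simp only: sum.insert o_apply) simp
    ultimately show ?case
      by (simp only:)
  next
    case empty
    show ?case
      using h(1) by simp
  qed
  have Hy0: "Hy n f = (\<lambda>m. 0)"
    unfolding f_def Hy_diff by (simp add: Hy_eq)
  have "(\<Sum>\<pi>\<in>?P. g (permute_list \<pi> x)) = 0" for x
  proof (cases "x \<in> seqs n")
    case True
    then show ?thesis
      using sum_permutations_eq_0[OF Hy0] by (simp add: g_def sum_divide_distrib[symmetric])
  next
    case False
    then have "g (permute_list \<pi> x) = 0" for \<pi>
      using g unfolding mem_gambles_iff[OF finite_seqs] by (simp add: seqs_def)
    then show ?thesis
      by simp
  qed
  moreover have "card ?P = fact n"
    by (rule card_permutations) auto
  ultimately have "h x + (\<Sum>\<pi>\<in>?P. g x - g (permute_list \<pi> x)) = h' x" for x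
    by (simp add: sum_subtractf g_def f_def)
  then show ?thesis
    using step[of ?P] by (simp add: finite_permutations)
qed

section \<open>Linear independence of the Bernstein polynomials\<close>

lemma CoMn_cmult: "CoMn n (\<lambda>m. c * g m) = (\<lambda>\<theta>. c * CoMn n g \<theta>)"
  by (simp add: CoMn_def sum_distrib_left mult.assoc)

lemma CoMn_add: "CoMn n (\<lambda>m. g m + h m) = (\<lambda>\<theta>. CoMn n g \<theta> + CoMn n h \<theta>)"
  by (simp add: CoMn_def sum.distrib distrib_right)

lemma CoMn_diff: "CoMn n (\<lambda>m. g m - h m) = (\<lambda>\<theta>. CoMn n g \<theta> - CoMn n h \<theta>)"
  by (simp add: CoMn_def sum_subtractf left_diff_distrib)

text \<open>The weights are the powers of \<open>n + 1\<close>, so that \<open>m\<close> is recovered from its digits in base \<open>n + 1\<close>.\<close>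

lemma separating_weights:
  assumes "finite A"
  shows "\<exists>w :: 'a \<Rightarrow> nat. \<forall>m m'. (\<forall>z\<in>A. m z \<le> n \<and> m' z \<le> n) \<longrightarrow>
           (\<Sum>z\<in>A. w z * m z) = (\<Sum>z\<in>A. w z * m' z) \<longrightarrow> (\<forall>z\<in>A. m z = m' z)"
  using assms
proof (induction A rule: finite_induct)
  case (insert a A)
  then obtain w :: "'a \<Rightarrow> nat" where
    w: "\<And>m m'. \<forall>z\<in>A. m z \<le> n \<and> m' z \<le> n \<Longrightarrow>
         (\<Sum>z\<in>A. w z * m z) = (\<Sum>z\<in>A. w z * m' z) \<Longrightarrow> \<forall>z\<in>A. m z = m' z"
    by blast
  \<comment> \<open>The new element becomes the lowest digit and the earlier digits move up one
    place. Since entries are at most \<open>n\<close>, reduction modulo \<open>Suc n\<close> reads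
    off the lowest digit.\<close>
  define w' where "w' z = (if z = a then 1 else Suc n * w z)" for z
  have w'_sum: "(\<Sum>z\<in>insert a A. w' z * m z) = m a + Suc n * (\<Sum>z\<in>A. w z * m z)" for m
  proof -
    have "(\<Sum>z\<in>A. w' z * m z) = (\<Sum>z\<in>A. Suc n * (w z * m z))"
      by (rule sum.cong) (use insert.hyps in \<open>auto simp: w'_def algebra_simps\<close>)
    then show ?thesis
      using insert.hyps by (simp add: w'_def sum_distrib_left)
  qed
  have "\<forall>z\<in>insert a A. m z = m' z"
    if le: "\<forall>z\<in>insert a A. m z \<le> n \<and> m' z \<le> n"
      and eq: "(\<Sum>z\<in>insert a A. w' z * m z) = (\<Sum>z\<in>insert a A. w' z * m' z)" for m m'
  proof -
    have *: "m a + Suc n * (\<Sum>z\<in>A. w z * m z) = m' a + Suc n * (\<Sum>z\<in>A. w z * m' z)"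
      using eq unfolding w'_sum .
    have digits: "(m a + Suc n * (\<Sum>z\<in>A. w z * m z)) mod Suc n = m a"
      "(m' a + Suc n * (\<Sum>z\<in>A. w z * m' z)) mod Suc n = m' a"
      using le by (simp_all only: mod_mult_self2) auto
    have "m a = m' a"
      using arg_cong[OF *, of "\<lambda>x. x mod Suc n"] unfolding digits .
    moreover from this have "(\<Sum>z\<in>A. w z * m z) = (\<Sum>z\<in>A. w z * m' z)"
      using * by (simp only: add_left_cancel nat_mult_eq_cancel1 zero_less_Suc)
    then have "\<forall>z\<in>A. m z = m' z"
      using le by (intro w) auto
    ultimately show ?thesis
      by simp
  qed
  then show ?case
    by blast
qed simp

text \<open>Entries of a count vector are bounded by their sum \<open>n\<close>, hence are valid
  digits in base \<open>n + 1\<close>.\<close>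

lemma separating_weights_count_vecs:
  obtains w :: "'x::finite \<Rightarrow> nat" where "inj_on (\<lambda>m. \<Sum>z\<in>UNIV. w z * m z) (count_vecs n)"
proof -
  obtain w :: "'x \<Rightarrow> nat" where
    w: "\<And>m m'. \<forall>z\<in>UNIV. m z \<le> n \<and> m' z \<le> n \<Longrightarrow>
         (\<Sum>z\<in>UNIV. w z * m z) = (\<Sum>z\<in>UNIV. w z * m' z) \<Longrightarrow> \<forall>z\<in>UNIV. m z = m' z"
    using separating_weights[of "UNIV :: 'x set" n] by auto
  have "m z \<le> n" if "m \<in> count_vecs n" for m :: "'x \<Rightarrow> nat" and z
    using that member_le_sum[of z UNIV m] by (simp add: count_vecs_def)
  then have "inj_on (\<lambda>m. \<Sum>z\<in>UNIV. w z * m z) (count_vecs n)"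
    using w by (intro inj_onI) (simp add: fun_eq_iff)
  then show ?thesis
    by (rule that)
qed

text \<open>
  Kronecker substitution: by homogeneity a combination of Bernstein polynomials that vanishes on
  the simplex vanishes along \<open>\<theta> z = t ^ w z\<close> for all \<open>t > 0\<close>, where distinct count vectors yield
  distinct powers of \<open>t\<close>.
\<close>

lemma CoMn_eq_0_imp:
  fixes g :: "('x::finite \<Rightarrow> nat) \<Rightarrow> real"
  assumes g: "g \<in> gambles (count_vecs n)" and eq0: "CoMn n g = (\<lambda>\<theta>. 0)"
  shows "g = (\<lambda>m. 0)"
proof -
  obtain w :: "'x \<Rightarrow> nat" where w: "inj_on (\<lambda>m. \<Sum>z\<in>UNIV. w z * m z) (count_vecs n)"
    using separating_weights_count_vecs by blast
  define e where "e m = (\<Sum>z\<in>UNIV. w z * m z)" for m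
  define c where "c m = g m * real (card (perm_class m))" for m
  define P where "P = (\<Sum>m\<in>count_vecs n. monom (c m) (e m))"
  have root: "poly P t = 0" if t: "0 < t" for t :: real
  proof -
    define S where "S = (\<Sum>z\<in>UNIV. t ^ w z)"
    \<comment> \<open>Dividing by \<open>S\<close> puts the curve on the simplex. As every
      \<open>m\<close> has total \<open>n\<close>, this only costs the common factor
      \<open>S ^ n\<close>.\<close>
    define \<theta> where "\<theta> = (\<chi> z. t ^ w z / S)"
    have S: "0 < S"
      unfolding S_def using t by (intro sum_pos) auto
    have \<theta>: "\<theta> \<in> prob_simplex"
      using t S by (simp add: prob_simplex_def \<theta>_def sum_divide_distrib[symmetric] S_def[symmetric])
    have b: "bernstein m \<theta> = real (card (perm_class m)) * (t ^ e m / S ^ n)" if "m \<in> count_vecs n" for m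
    proof -
      have "(\<Prod>z\<in>UNIV. (\<theta> $ z) ^ m z) = (\<Prod>z\<in>UNIV. t ^ (w z * m z) / S ^ m z)"
        by (simp add: \<theta>_def power_divide power_mult)
      also have "\<dots> = t ^ e m / S ^ n"
        using that by (simp add: prod_dividef power_sum[symmetric] e_def count_vecs_def)
      finally show ?thesis
        using \<theta> by (simp add: bernstein_def zero_ext_def)
    qed
    have "poly P t = (\<Sum>m\<in>count_vecs n. c m * t ^ e m)"
      by (simp add: P_def poly_sum poly_monom)
    also have "\<dots> = S ^ n * CoMn n g \<theta>"
      using S by (simp add: CoMn_def b c_def sum_distrib_left mult.assoc)
    finally show ?thesis
      by (simp add: eq0)
  qed
  have "P = 0"
  proof (rule ccontr)
    assume "P \<noteq> 0"
    then have "finite {t. poly P t = 0}"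
      by (rule poly_roots_finite)
    then have "finite {0<..<1::real}"
      by (rule rev_finite_subset) (auto simp: root)
    then show False
      by (simp add: infinite_Ioo)
  qed
  have "g m = 0" if m: "m \<in> count_vecs n" for m
  proof -
    have "0 = coeff P (e m)"
      by (simp add: \<open>P = 0\<close>)
    \<comment> \<open>Exponents of distinct count vectors differ, so only the term of
      \<open>m\<close> contributes to the coefficient at \<open>e m\<close>.\<close>
    also have "\<dots> = (\<Sum>m'\<in>count_vecs n. if m' = m then c m' else 0)"
      unfolding P_def coeff_sum
      by (rule sum.cong) (use w m in \<open>auto simp: e_def inj_on_def\<close>)
    also have "\<dots> = c m"
      using m by simp
    finally show ?thesis
      using card_perm_class_pos[of m] by (simp add: c_def)
  qed
  then show ?thesis
    using g by (auto simp: mem_gambles_iff)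
qed

lemma CoMn_inject:
  assumes "g \<in> gambles (count_vecs n)" "h \<in> gambles (count_vecs n)"
  shows "CoMn n g = CoMn n h \<longleftrightarrow> g = h"
proof
  assume "CoMn n g = CoMn n h"
  then have "CoMn n (\<lambda>m. g m - h m) = (\<lambda>\<theta>. 0)"
    by (simp add: CoMn_diff)
  then have "(\<lambda>m. g m - h m) = (\<lambda>m. 0)"
    using assms by (intro CoMn_eq_0_imp gambles_diff)
  then show "g = h"
    by (simp add: fun_eq_iff)
qed simp

text \<open>Linear independence provides the uniqueness that the definite description in
  \<open>bernstein_expansion\<close> asks for.\<close>

lemma bernstein_expansion_CoMn:
  assumes "g \<in> gambles (count_vecs n)"
  shows "bernstein_expansion n (CoMn n g) = g"
  unfolding bernstein_expansion_def CoMn_def[symmetric]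
  using assms by (intro the_equality) (auto simp: CoMn_inject)

section \<open>The map \<open>Mn\<close> as an expectation under multinomial sampling\<close>

lemma Mn_cmult: "Mn n (\<lambda>x. c * f x) = (\<lambda>\<theta>. c * Mn n f \<theta>)"
  by (simp add: Mn_def Hy_cmult CoMn_cmult)

lemma Mn_add: "Mn n (\<lambda>x. f x + g x) = (\<lambda>\<theta>. Mn n f \<theta> + Mn n g \<theta>)"
  by (simp add: Mn_def Hy_add CoMn_add)

lemma Mn_zero: "Mn n (\<lambda>x. 0) = (\<lambda>\<theta>. 0)"
  using Mn_cmult[of n 0] by simp

lemma Mn_eq_iff: "Mn n f = Mn n g \<longleftrightarrow> Hy n f = Hy n g"
  by (simp add: Mn_def CoMn_inject)

lemma Mn_count_gamble: "g \<in> gambles (count_vecs n) \<Longrightarrow> Mn n (count_gamble n g) = CoMn n g"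
  by (simp add: Mn_def Hy_count_gamble)

lemma prod_list_eq_prod_count:
  fixes \<theta> :: "real ^ 'x::finite"
  shows "(\<Prod>x\<leftarrow>y. \<theta> $ x) = (\<Prod>z\<in>UNIV. (\<theta> $ z) ^ count_list y z)"
proof (induction y)
  case (Cons a y)
  have "(\<Prod>z\<in>UNIV. (\<theta> $ z) ^ count_list (a # y) z)
      = (\<Prod>z\<in>UNIV. (if a = z then \<theta> $ z else 1) * (\<theta> $ z) ^ count_list y z)"
    by (rule prod.cong) auto
  then show ?case
    using Cons by (simp add: prod.distrib)
qed simp

text \<open>The class size in \<open>bernstein\<close> cancels the averaging in \<open>Hy\<close>,
  and what is left is the sum over all sequences grouped by count vector.\<close>

lemma Mn_eq:
  "Mn n f = zero_ext prob_simplex (\<lambda>\<theta>. \<Sum>y\<in>seqs n. f y * (\<Prod>x\<leftarrow>y. \<theta> $ x))"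
proof
  fix \<theta> :: "real ^ 'a"
  show "Mn n f \<theta> = zero_ext prob_simplex (\<lambda>\<theta>. \<Sum>y\<in>seqs n. f y * (\<Prod>x\<leftarrow>y. \<theta> $ x)) \<theta>"
  proof (cases "\<theta> \<in> prob_simplex")
    case True
    have *: "Hy n f m * bernstein m \<theta> = (\<Sum>y | y \<in> seqs n \<and> count_list y = m. f y * (\<Prod>x\<leftarrow>y. \<theta> $ x))"
      if m: "m \<in> count_vecs n" for m
    proof -
      have "Hy n f m * bernstein m \<theta> = (\<Sum>y\<in>perm_class m. f y * (\<Prod>z\<in>UNIV. (\<theta> $ z) ^ m z))"
        using m True by (simp add: Hy_def bernstein_def zero_ext_def sum_distrib_right sum_divide_distrib)
      also have "\<dots> = (\<Sum>y\<in>perm_class m. f y * (\<Prod>x\<leftarrow>y. \<theta> $ x))"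
        by (rule sum.cong) (use m in \<open>auto simp: perm_class_eq prod_list_eq_prod_count\<close>)
      finally show ?thesis
        by (simp only: perm_class_eq[OF m])
    qed
    have "Mn n f \<theta> = (\<Sum>m\<in>count_vecs n. \<Sum>y | y \<in> seqs n \<and> count_list y = m. f y * (\<Prod>x\<leftarrow>y. \<theta> $ x))"
      by (simp add: Mn_def CoMn_def *)
    also have "\<dots> = (\<Sum>y\<in>seqs n. f y * (\<Prod>x\<leftarrow>y. \<theta> $ x))"
      by (rule sum.group) auto
    finally show ?thesis
      using True by (simp add: zero_ext_def)
  qed (simp add: Mn_def CoMn_def bernstein_def zero_ext_def)
qed

text \<open>The distributive law for a product of \<open>n\<close> equal sums. On the simplex it
  says that the probabilities of all sequences of length \<open>n\<close> add up to one.\<close>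

lemma sum_seqs_prod_list:
  fixes \<theta> :: "real ^ 'x::finite"
  shows "(\<Sum>y\<in>seqs n. \<Prod>x\<leftarrow>y. \<theta> $ x) = (\<Sum>z\<in>UNIV. \<theta> $ z) ^ n"
proof (induction n)
  case (Suc n)
  have "(\<Sum>y\<in>seqs (Suc n). \<Prod>x\<leftarrow>y. \<theta> $ x)
      = (\<Sum>(a, y)\<in>UNIV \<times> seqs n. \<theta> $ a * (\<Prod>x\<leftarrow>y. \<theta> $ x))"
    by (rule sum.reindex_bij_witness[where i = "\<lambda>(a, y). a # y" and j = "\<lambda>y. (hd y, tl y)"])
       (auto simp: seqs_def length_Suc_conv)
  also have "\<dots> = (\<Sum>z\<in>UNIV. \<theta> $ z) * (\<Sum>y\<in>seqs n. \<Prod>x\<leftarrow>y. \<theta> $ x)"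
    by (simp add: sum.cartesian_product[symmetric] sum_product)
  finally show ?case
    using Suc by simp
qed (simp add: seqs_def)

section \<open>Cylindrical extension\<close>

lemma cyl_ext_in_gambles [simp]: "cyl_ext n1 n2 f \<in> gambles (seqs n2 :: 'x::finite list set)"
  by (simp add: cyl_ext_def zero_ext_in_gambles)

lemma cyl_ext_inject:
  fixes f g :: "'x::finite list \<Rightarrow> real"
  assumes "n1 \<le> n2" "f \<in> gambles (seqs n1)" "g \<in> gambles (seqs n1)"
  shows "cyl_ext n1 n2 f = cyl_ext n1 n2 g \<longleftrightarrow> f = g"
proof
  assume eq: "cyl_ext n1 n2 f = cyl_ext n1 n2 g"
  have "f x = g x" for x
  proof (cases "x \<in> seqs n1")
    case True
    \<comment> \<open>The padding letter is arbitrary, because the extension reads only the first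
      \<open>n1\<close> entries.\<close>
    define y where "y = x @ replicate (n2 - n1) undefined"
    have "y \<in> seqs n2" "take n1 y = x"
      using True assms(1) by (simp_all add: y_def seqs_def)
    then show ?thesis
      using fun_cong[OF eq, of y] by (simp add: cyl_ext_def zero_ext_def)
  qed (use assms in \<open>simp add: mem_gambles_iff\<close>)
  then show "f = g" ..
qed simp

text \<open>Cutting each sequence after \<open>n1\<close> entries factors the sum, and the factor of
  the later draws is a total probability, hence one.\<close>

lemma Mn_cyl_ext:
  fixes f :: "'x::finite list \<Rightarrow> real"
  assumes "n1 \<le> n2"
  shows "Mn n2 (cyl_ext n1 n2 f) = Mn n1 f"
proof -
  have "(\<Sum>y\<in>seqs n2. cyl_ext n1 n2 f y * (\<Prod>x\<leftarrow>y. \<theta> $ x)) = (\<Sum>y\<in>seqs n1. f y * (\<Prod>x\<leftarrow>y. \<theta> $ x))"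
    if "\<theta> \<in> prob_simplex" for \<theta> :: "real ^ 'x"
  proof -
    have "(\<Sum>y\<in>seqs n2. cyl_ext n1 n2 f y * (\<Prod>x\<leftarrow>y. \<theta> $ x))
        = (\<Sum>(u, v)\<in>seqs n1 \<times> seqs (n2 - n1). f u * (\<Prod>x\<leftarrow>u. \<theta> $ x) * (\<Prod>x\<leftarrow>v. \<theta> $ x))"
      by (rule sum.reindex_bij_witness[where i = "\<lambda>(u, v). u @ v" and j = "\<lambda>y. (take n1 y, drop n1 y)"])
         (use assms in \<open>auto simp: seqs_def cyl_ext_def zero_ext_def mult.assoc
            simp flip: prod_list.append map_append\<close>)
    also have "\<dots> = (\<Sum>u\<in>seqs n1. f u * (\<Prod>x\<leftarrow>u. \<theta> $ x)) * (\<Sum>v\<in>seqs (n2 - n1). \<Prod>x\<leftarrow>v. \<theta> $ x)"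
      by (simp add: sum.cartesian_product[symmetric] sum_product)
    finally show ?thesis
      using that by (simp add: sum_seqs_prod_list prob_simplex_def)
  qed
  then show ?thesis
    by (auto simp: Mn_eq zero_ext_def fun_eq_iff)
qed

section \<open>Polynomials on the simplex\<close>

text \<open>Each Bernstein polynomial is a multiple of one monomial of total degree exactly
  \<open>n\<close>; all other coefficients are set to zero.\<close>

lemma CoMn_in_polys_upto: "CoMn n g \<in> polys_upto n"
proof -
  define c where "c m = (if m \<in> count_vecs n then g m * real (card (perm_class m)) else 0)" for m
  have "(\<Sum>\<alpha> | (\<Sum>z\<in>UNIV. \<alpha> z) \<le> n. c \<alpha> * (\<Prod>z\<in>UNIV. (\<theta> $ z) ^ \<alpha> z))
      = (\<Sum>m\<in>count_vecs n. g m * (real (card (perm_class m)) * (\<Prod>z\<in>UNIV. (\<theta> $ z) ^ m z)))" for \<theta>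
    by (rule sum.mono_neutral_cong_right)
       (auto simp: finite_count_vecs_le c_def count_vecs_def)
  then have "CoMn n g = zero_ext prob_simplex
      (\<lambda>\<theta>. \<Sum>\<alpha> | (\<Sum>z\<in>UNIV. \<alpha> z) \<le> n. c \<alpha> * (\<Prod>z\<in>UNIV. (\<theta> $ z) ^ \<alpha> z))"
    by (auto simp: CoMn_def bernstein_def zero_ext_def fun_eq_iff)
  then show ?thesis
    unfolding polys_upto_def by blast
qed

lemma Mn_in_polys_upto: "Mn n f \<in> polys_upto n"
  by (simp add: Mn_def CoMn_in_polys_upto)

text \<open>The monomial is the probability of one fixed sequence \<open>y\<close> with counts
  \<open>\<alpha>\<close>, so the indicator of \<open>y\<close> represents it; cylindrical extension
  raises the length from \<open>k\<close> to \<open>n\<close>.\<close>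

lemma monomial_eq_Mn:
  fixes \<alpha> :: "'x::finite \<Rightarrow> nat"
  assumes "(\<Sum>z\<in>UNIV. \<alpha> z) \<le> n"
  shows "\<exists>f\<in>gambles (seqs n). Mn n f = zero_ext prob_simplex (\<lambda>\<theta>. \<Prod>z\<in>UNIV. (\<theta> $ z) ^ \<alpha> z)"
proof -
  define k where "k = (\<Sum>z\<in>UNIV. \<alpha> z)"
  have k: "\<alpha> \<in> count_vecs k"
    by (simp add: count_vecs_def k_def)
  obtain y where "y \<in> perm_class \<alpha>"
    using perm_class_nonempty[of \<alpha>] by blast
  then have y: "y \<in> seqs k" "count_list y = \<alpha>"
    using k by (auto simp: perm_class_eq)
  have "Mn k (\<lambda>x. if x = y then 1 else 0) = zero_ext prob_simplex (\<lambda>\<theta>. \<Prod>z\<in>UNIV. (\<theta> $ z) ^ \<alpha> z)"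
    using y by (simp add: Mn_eq if_distrib[of "\<lambda>c. c * _"] prod_list_eq_prod_count cong: if_cong)
  then have "Mn n (cyl_ext k n (\<lambda>x. if x = y then 1 else 0)) = zero_ext prob_simplex (\<lambda>\<theta>. \<Prod>z\<in>UNIV. (\<theta> $ z) ^ \<alpha> z)"
    using assms by (simp add: Mn_cyl_ext k_def)
  then show ?thesis
    by (intro bexI[of _ "cyl_ext k n (\<lambda>x. if x = y then 1 else 0)"]) auto
qed

lemma Mn_sum: "Mn n (\<lambda>x. \<Sum>i\<in>A. f i x) = (\<lambda>\<theta>. \<Sum>i\<in>A. Mn n (f i) \<theta>)"
  by (induction A rule: infinite_finite_induct) (simp_all add: Mn_zero Mn_add)

text \<open>Monomials are images of gambles and \<open>Mn n\<close> is linear, so coefficients can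
  be carried over to the gambles.\<close>

lemma polys_upto_eq_Mn: "(polys_upto n :: (real ^ 'x::finite \<Rightarrow> real) set) = Mn n ` gambles (seqs n)"
proof (intro subset_antisym subsetI)
  fix p :: "real ^ 'x \<Rightarrow> real"
  assume "p \<in> polys_upto n"
  then obtain c where p: "p = zero_ext prob_simplex
      (\<lambda>\<theta>. \<Sum>\<alpha> | (\<Sum>z\<in>UNIV. \<alpha> z) \<le> n. c \<alpha> * (\<Prod>z\<in>UNIV. (\<theta> $ z) ^ \<alpha> z))"
    by (auto simp: polys_upto_def)
  define A where "A = {\<alpha> :: 'x \<Rightarrow> nat. (\<Sum>z\<in>UNIV. \<alpha> z) \<le> n}"
  have "\<forall>\<alpha>\<in>A. \<exists>f. f \<in> gambles (seqs n) \<and>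
      Mn n f = zero_ext prob_simplex (\<lambda>\<theta>. \<Prod>z\<in>UNIV. (\<theta> $ z) ^ \<alpha> z)"
    using monomial_eq_Mn unfolding A_def by blast
  from bchoice[OF this] obtain F where F: "\<And>\<alpha>. \<alpha> \<in> A \<Longrightarrow> F \<alpha> \<in> gambles (seqs n)"
    "\<And>\<alpha>. \<alpha> \<in> A \<Longrightarrow> Mn n (F \<alpha>) = zero_ext prob_simplex (\<lambda>\<theta>. \<Prod>z\<in>UNIV. (\<theta> $ z) ^ \<alpha> z)"
    by blast
  define f where "f x = (\<Sum>\<alpha>\<in>A. c \<alpha> * F \<alpha> x)" for x
  have "f \<in> gambles (seqs n)"
    using F(1) by (auto simp: f_def mem_gambles_iff intro!: sum.neutral)
  moreover have "Mn n f = p"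
    unfolding f_def Mn_sum Mn_cmult p A_def[symmetric]
    by (auto simp: fun_eq_iff F(2) zero_ext_def)
  ultimately show "p \<in> Mn n ` gambles (seqs n)"
    by blast
qed (auto simp: Mn_in_polys_upto)

text \<open>Cylindrical extension takes the place of padding the coefficients with zeros.\<close>

lemma polys_upto_mono:
  assumes "n1 \<le> n2"
  shows "(polys_upto n1 :: (real ^ 'x::finite \<Rightarrow> real) set) \<subseteq> polys_upto n2"
proof
  fix p :: "real ^ 'x \<Rightarrow> real"
  assume "p \<in> polys_upto n1"
  then obtain f where "p = Mn n1 f"
    by (auto simp: polys_upto_eq_Mn)
  then have "p = Mn n2 (cyl_ext n1 n2 f)"
    using assms by (simp add: Mn_cyl_ext)
  then show "p \<in> polys_upto n2"
    by (simp add: Mn_in_polys_upto)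
qed

lemma poly_deg_le: "p \<in> polys_upto n \<Longrightarrow> poly_deg p \<le> n"
  unfolding poly_deg_def by (rule Least_le)

lemma polys_upto_poly_deg:
  assumes "p \<in> polys" "poly_deg p \<le> n"
  shows "p \<in> polys_upto n"
proof -
  have "p \<in> polys_upto (poly_deg p)"
    using assms(1) unfolding poly_deg_def polys_def by (auto intro: LeastI)
  then show ?thesis
    using polys_upto_mono[OF assms(2)] by blast
qed

lemma polys_eq_CoMn:
  assumes "p \<in> polys" "poly_deg p \<le> n"
  obtains g where "g \<in> gambles (count_vecs n)" "p = CoMn n g" "bernstein_expansion n p = g"
proof -
  obtain f where "p = Mn n f"
    using polys_upto_poly_deg[OF assms] by (auto simp: polys_upto_eq_Mn)
  then have "p = CoMn n (Hy n f)"
    by (simp add: Mn_def)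
  then show ?thesis
    using that[of "Hy n f"] by (simp add: bernstein_expansion_CoMn)
qed

lemma polys_eq_Mn:
  assumes "p \<in> polys"
  obtains n f where "1 \<le> n" "f \<in> gambles (seqs n)" "p = Mn n f"
proof -
  \<comment> \<open>The successor guarantees a positive length even for constants, whose degree is
    0.\<close>
  have "p \<in> polys_upto (Suc (poly_deg p))"
    using polys_upto_poly_deg[OF assms] by simp
  then show ?thesis
    using that[of "Suc (poly_deg p)"] by (auto simp: polys_upto_eq_Mn)
qed

section \<open>Representation\<close>

text \<open>
  Extend both gambles to a common length: there the extensions have the same image under \<open>Hy\<close>,
  so exchangeability applies, and time consistency brings the result back to length \<open>n\<close>.
\<close>

lemma tc_coherent_exchangeable_Mn_cong:
  fixes R :: "nat \<Rightarrow> ('x::finite list \<Rightarrow> real) set"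
  assumes tc: "tc_coherent_exchangeable R" and n: "1 \<le> n" and k: "1 \<le> k"
    and h: "h \<in> R k" and f: "f \<in> gambles (seqs n)" and eq: "Mn n f = Mn k h"
  shows "f \<in> R n"
proof -
  define N where "N = max n k"
  have N: "n \<le> N" "k \<le> N" "1 \<le> N"
    using n by (auto simp: N_def)
  have exch: "exchangeable N (R N)"
    using tc N by (auto simp: tc_coherent_exchangeable_def)
  have ext: "cyl_ext j N ` R j = R N \<inter> cyl_ext j N ` gambles (seqs j)" if "1 \<le> j" "j \<le> N" for j
    using tc that by (auto simp: tc_coherent_exchangeable_def time_consistent_def)
  have "cyl_ext k N h \<in> R N"
    using ext[OF k N(2)] h by blast
  moreover have "Hy N (cyl_ext k N h) = Hy N (cyl_ext n N f)"
    using eq N by (simp add: Mn_eq_iff[symmetric] Mn_cyl_ext)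
  ultimately have "cyl_ext n N f \<in> R N"
    using exchangeable_Hy_cong[OF exch _ cyl_ext_in_gambles cyl_ext_in_gambles] by simp
  then have "cyl_ext n N f \<in> cyl_ext n N ` R n"
    unfolding ext[OF n N(1)] using f by simp
  \<comment> \<open>Time consistency only yields some \<open>f'\<close> with the same extension;
    injectivity of extension then identifies it with \<open>f\<close>.\<close>
  then obtain f' where f': "f' \<in> R n" "cyl_ext n N f = cyl_ext n N f'"
    by blast
  have "f' \<in> gambles (seqs n)"
    using tc n f'(1) by (auto simp: tc_coherent_exchangeable_def coherent_def)
  then have "f = f'"
    using f'(2) cyl_ext_inject[OF N(1) f] by blast
  then show ?thesis
    using f'(1) by simp
qed

lemma tc_coherent_exchangeable_imp_representation:
  fixes R :: "nat \<Rightarrow> ('x::finite list \<Rightarrow> real) set"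
  assumes tc: "tc_coherent_exchangeable R"
  defines "H \<equiv> \<Union>n\<in>{1..}. Mn n ` R n"
  shows "bernstein_coherent H" "represents H R"
proof -
  have coh: "coherent (seqs n) (R n)" if "1 \<le> n" for n
    using tc that by (simp add: tc_coherent_exchangeable_def)
  have gam: "R n \<subseteq> gambles (seqs n)" if "1 \<le> n" for n
    using coh[OF that] by (simp add: coherent_def)
  \<comment> \<open>\<open>H\<close> collects images from all lengths, yet any single positive
    length decides whether the image of one of its gambles belongs to \<open>H\<close>.\<close>
  have mem_H: "Mn n f \<in> H \<longleftrightarrow> f \<in> R n" if "1 \<le> n" "f \<in> gambles (seqs n)" for n f
  proof
    assume "Mn n f \<in> H"
    then obtain k h where "1 \<le> k" "h \<in> R k" "Mn n f = Mn k h"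
      by (auto simp: H_def)
    then show "f \<in> R n"
      using tc_coherent_exchangeable_Mn_cong[OF tc] that by blast
  qed (use that in \<open>auto simp: H_def\<close>)
  \<comment> \<open>Elements of \<open>H\<close> can be moved to any larger length, so that two of
    them can be added at a common one.\<close>
  have lift: "\<exists>h\<in>R N. Mn N h = Mn n f" if "1 \<le> n" "n \<le> N" "f \<in> R n" for n N f
  proof
    show eq: "Mn N (cyl_ext n N f) = Mn n f"
      using that by (simp add: Mn_cyl_ext)
    have "Mn n f \<in> H"
      using that by (auto simp: H_def)
    then show "cyl_ext n N f \<in> R N"
      using that mem_H[of N "cyl_ext n N f"] by (simp add: eq)
  qed
  show "represents H R"
    unfolding represents_def
  proof (intro allI impI conjI)
    fix n :: nat assume n: "1 \<le> n"
    show Rn: "R n = {f \<in> gambles (seqs n). Mn n f \<in> H}"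
      using gam[OF n] mem_H[OF n] by blast
    show "Hy n ` R n = {g \<in> gambles (count_vecs n). CoMn n g \<in> H}"
    proof (intro subset_antisym subsetI)
      fix g assume "g \<in> {g \<in> gambles (count_vecs n). CoMn n g \<in> H}"
      then have g: "g \<in> gambles (count_vecs n)" "CoMn n g \<in> H"
        by auto
      then have "count_gamble n g \<in> R n"
        using mem_H[OF n, of "count_gamble n g"] by (simp add: Mn_count_gamble)
      then show "g \<in> Hy n ` R n"
        using g(1) by (metis Hy_count_gamble imageI)
    qed (use Rn in \<open>auto simp: Mn_def\<close>)
  qed
  show "bernstein_coherent H"
    unfolding bernstein_coherent_def
  proof (intro conjI ballI allI impI)
    show "H \<subseteq> polys"
      using Mn_in_polys_upto by (fastforce simp: H_def polys_def)
    show "(\<lambda>\<theta>. 0) \<notin> H"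
      using mem_H[of 1 "\<lambda>x. 0"] coh[of 1] by (simp add: Mn_zero coherent_def)
  next
    fix p :: "real ^ 'x \<Rightarrow> real"
    assume p: "p \<in> polys" and "\<exists>n\<ge>poly_deg p. (\<lambda>m. 0) < bernstein_expansion n p"
    then obtain n where n: "poly_deg p \<le> n" "(\<lambda>m. 0) < bernstein_expansion n p"
      by blast
    then obtain g where g: "g \<in> gambles (count_vecs n)" "p = CoMn n g" "(\<lambda>m. 0) < g"
      using polys_eq_CoMn[OF p n(1)] by metis
    \<comment> \<open>The given degree \<open>n\<close> may be 0, whereas the family is constrained
      only from length 1 on; one extra draw changes neither the polynomial nor positivity.\<close>
    define f where "f = cyl_ext n (Suc n) (count_gamble n g)"
    have "p = Mn (Suc n) f"
      using g by (simp add: f_def Mn_cyl_ext Mn_count_gamble)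
    moreover have "(\<lambda>x. 0) < f"
    proof -
      have pos: "(\<lambda>x. 0) < count_gamble n g"
        using g by (intro count_gamble_pos)
      then have nonneg: "0 \<le> f x" for x
        by (simp add: zero_less_fun_iff f_def cyl_ext_def zero_ext_def)
      moreover have "f \<noteq> (\<lambda>x. 0)"
      proof
        assume "f = (\<lambda>x. 0)"
        \<comment> \<open>Extension is injective and sends zero to zero, so a nonzero gamble stays
          nonzero.\<close>
        then have "f = cyl_ext n (Suc n) (\<lambda>x. 0)"
          by (simp add: cyl_ext_def zero_ext_def)
        then have "count_gamble n g = (\<lambda>x. 0)"
          using cyl_ext_inject[of n "Suc n" "count_gamble n g" "\<lambda>x. 0"] by (simp add: f_def)
        then show False
          using pos by simp
      qed
      ultimately show ?thesis
        by (auto simp: zero_less_fun_iff fun_eq_iff less_le)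
    qed
    then have "f \<in> R (Suc n)"
      using coh[of "Suc n"] unfolding coherent_def f_def by simp
    ultimately show "p \<in> H"
      unfolding H_def by (intro UN_I[of "Suc n"]) auto
  next
    fix p :: "real ^ 'x \<Rightarrow> real" and c :: real
    assume "p \<in> H" "0 < c"
    then obtain n f where f: "1 \<le> n" "f \<in> R n" "p = Mn n f"
      by (auto simp: H_def)
    then have "(\<lambda>x. c * f x) \<in> R n"
      using coh[OF f(1)] \<open>0 < c\<close> by (simp add: coherent_def)
    then show "(\<lambda>\<theta>. c * p \<theta>) \<in> H"
      using mem_H[OF f(1), of "\<lambda>x. c * f x"] gam[OF f(1)] f(3) by (auto simp: Mn_cmult)
  next
    fix p1 p2 :: "real ^ 'x \<Rightarrow> real"
    assume "p1 \<in> H" "p2 \<in> H"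
    then obtain n1 f1 n2 f2 where f: "1 \<le> n1" "f1 \<in> R n1" "p1 = Mn n1 f1"
      "1 \<le> n2" "f2 \<in> R n2" "p2 = Mn n2 f2"
      by (auto simp: H_def)
    define N where "N = max n1 n2"
    have "n1 \<le> N" "n2 \<le> N"
      by (simp_all add: N_def)
    then obtain h1 h2 where h: "h1 \<in> R N" "Mn N h1 = p1" "h2 \<in> R N" "Mn N h2 = p2"
      using lift f by metis
    have N: "1 \<le> N"
      using f by (simp add: N_def)
    have "(\<lambda>x. h1 x + h2 x) \<in> R N"
      using coh[OF N] h by (simp add: coherent_def)
    then show "(\<lambda>\<theta>. p1 \<theta> + p2 \<theta>) \<in> H"
      using mem_H[OF N, of "\<lambda>x. h1 x + h2 x"] gam[OF N] h by (auto simp: Mn_add)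
  qed
qed

text \<open>The axioms pull back along \<open>Mn n\<close>: scaling and addition by linearity,
  exchangeability by invariance under permutations, time consistency by invariance under
  extension.\<close>

lemma representation_imp_tc_coherent_exchangeable:
  fixes R :: "nat \<Rightarrow> ('x::finite list \<Rightarrow> real) set"
  assumes H: "bernstein_coherent H" and R: "represents H R"
  shows "tc_coherent_exchangeable R"
proof -
  have mem_R: "f \<in> R n \<longleftrightarrow> f \<in> gambles (seqs n) \<and> Mn n f \<in> H" if "1 \<le> n" for n f
  proof -
    have "R n = {f \<in> gambles (seqs n). Mn n f \<in> H}"
      using R that by (simp add: represents_def)
    then show ?thesis
      by blast
  qed
  have "coherent (seqs n) (R n)" if n: "1 \<le> n" for n
    unfolding coherent_def
  proof (intro conjI ballI allI impI)
    show "R n \<subseteq> gambles (seqs n)"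
      using mem_R[OF n] by blast
    show "(\<lambda>x. 0) \<notin> R n"
      using mem_R[OF n] H by (simp add: Mn_zero bernstein_coherent_def)
  next
    fix f :: "'x list \<Rightarrow> real"
    assume f: "f \<in> gambles (seqs n)" "(\<lambda>x. 0) < f"
    \<comment> \<open>The degree \<open>n\<close> expansion of \<open>Mn n f\<close> is
      \<open>Hy n f\<close>, so positivity of \<open>f\<close> becomes positivity of a Bernstein
      expansion.\<close>
    have "bernstein_expansion n (Mn n f) = Hy n f"
      by (simp add: Mn_def bernstein_expansion_CoMn)
    moreover have "poly_deg (Mn n f) \<le> n"
      by (simp add: poly_deg_le Mn_in_polys_upto)
    moreover have "Mn n f \<in> polys"
      unfolding polys_def using Mn_in_polys_upto by blast
    ultimately have "Mn n f \<in> H"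
      using H Hy_pos[OF f] unfolding bernstein_coherent_def by metis
    then show "f \<in> R n"
      using mem_R[OF n] f(1) by blast
  next
    fix f and c :: real
    assume "f \<in> R n" "0 < c"
    then show "(\<lambda>x. c * f x) \<in> R n"
      using mem_R[OF n] H by (simp add: gambles_cmult Mn_cmult bernstein_coherent_def)
  next
    fix f1 f2
    assume "f1 \<in> R n" "f2 \<in> R n"
    then show "(\<lambda>x. f1 x + f2 x) \<in> R n"
      using mem_R[OF n] H by (simp add: gambles_add Mn_add bernstein_coherent_def)
  qed
  moreover have "exchangeable n (R n)" if n: "1 \<le> n" for n
    unfolding exchangeable_def
  proof (intro ballI allI impI)
    fix h f :: "'x list \<Rightarrow> real" and \<pi>
    assume h: "h \<in> R n" and f: "f \<in> gambles (seqs n)" and \<pi>: "\<pi> permutes {..<n}"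
    have "f \<circ> permute_list \<pi> \<in> gambles (seqs n)"
      using f unfolding mem_gambles_iff[OF finite_seqs] by (simp add: seqs_def)
    then have "(\<lambda>x. h x + (f x - (f \<circ> permute_list \<pi>) x)) \<in> gambles (seqs n)"
      using h f mem_R[OF n] by (intro gambles_add gambles_diff) (simp_all only:)
    moreover have "Hy n (\<lambda>x. h x + (f x - (f \<circ> permute_list \<pi>) x)) = Hy n h"
      unfolding Hy_add Hy_diff Hy_permute[OF \<pi>] by simp
    then have "Mn n (\<lambda>x. h x + (f x - (f \<circ> permute_list \<pi>) x)) = Mn n h"
      by (simp only: Mn_eq_iff)
    ultimately show "(\<lambda>x. h x + (f x - (f \<circ> permute_list \<pi>) x)) \<in> R n"
      using h mem_R[OF n] by (simp only:)
  qed
  moreover have "time_consistent R"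
    unfolding time_consistent_def
  proof (intro allI impI)
    fix n1 n2 :: nat
    assume "1 \<le> n1 \<and> n1 \<le> n2"
    then have n: "1 \<le> n1" "1 \<le> n2" "n1 \<le> n2"
      by auto
    \<comment> \<open>Time consistency concerns only those members of \<open>R n2\<close> that are
      extensions, so this equivalence is all it asks.\<close>
    have "cyl_ext n1 n2 f \<in> R n2 \<longleftrightarrow> f \<in> R n1" if "f \<in> gambles (seqs n1)" for f
      using that n by (simp add: mem_R Mn_cyl_ext)
    then show "cyl_ext n1 n2 ` R n1 = R n2 \<inter> cyl_ext n1 n2 ` gambles (seqs n1)"
      using mem_R[OF n(1)] by blast
  qed
  ultimately show ?thesis
    by (simp add: tc_coherent_exchangeable_def)
qed

text \<open>Every polynomial is \<open>Mn n f\<close> for a gamble \<open>f\<close> of some positive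
  length \<open>n\<close>, so the sets \<open>R n\<close> decide membership of every polynomial in
  \<open>H\<close>.\<close>

lemma representation_unique:
  fixes R :: "nat \<Rightarrow> ('x::finite list \<Rightarrow> real) set"
  assumes "bernstein_coherent H" "represents H R"
  shows "H = (\<Union>n\<in>{1..}. Mn n ` R n)"
proof (intro subset_antisym subsetI)
  fix p assume p: "p \<in> H"
  then have "p \<in> polys"
    using assms(1) by (auto simp: bernstein_coherent_def)
  then obtain n f where f: "1 \<le> n" "f \<in> gambles (seqs n)" "p = Mn n f"
    by (rule polys_eq_Mn)
  then have "f \<in> R n"
    using assms(2) p by (auto simp: represents_def)
  then show "p \<in> (\<Union>n\<in>{1..}. Mn n ` R n)"
    using f by auto
qed (use assms(2) in \<open>auto simp: represents_def\<close>)

theorem theorem22: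
  fixes R :: "nat \<Rightarrow> ('x::finite list \<Rightarrow> real) set"
  assumes "\<And>n. n \<ge> 1 \<Longrightarrow> R n \<subseteq> gambles (seqs n)"
  shows "(tc_coherent_exchangeable R \<longleftrightarrow> (\<exists>H. bernstein_coherent H \<and> represents H R)) \<and>
         (\<forall>H. bernstein_coherent H \<and> represents H R \<longrightarrow> H = (\<Union>n\<in>{1..}. Mn n ` R n))"
proof (intro conjI iffI allI impI)
  assume "tc_coherent_exchangeable R"
  note representation = tc_coherent_exchangeable_imp_representation[OF this]
  show "\<exists>H. bernstein_coherent H \<and> represents H R"
    using representation by (intro exI conjI)
next
  assume "\<exists>H. bernstein_coherent H \<and> represents H R"
  then obtain H where "bernstein_coherent H" "represents H R"
    by (elim exE conjE)
  then show "tc_coherent_exchangeable R"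
    by (rule representation_imp_tc_coherent_exchangeable)
next
  fix H assume "bernstein_coherent H \<and> represents H R"
  then show "H = (\<Union>n\<in>{1..}. Mn n ` R n)"
    by (elim conjE) (rule representation_unique)
qed

end
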